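(* Let $n$ be a positive integer, and for $1\leq r\leq n$ let $\nu_r(n)$ be the maximum size of a null subsemigroup of $\mathcal T_n$ whose zero element has rank $r$. Then: (i) for any $1\leq r\leq n$, $\nu_r(n)=\xi(n-r+1)$; (ii) $\nu_1(n)>\nu_2(n)>\cdots>\nu_{n-1}(n)=\nu_n(n)=1$; (iii) the maximum size $\nu(n)$ of a null subsemigroup of $\mathcal T_n$ equals $\nu_1(n)=\xi(n)$; moreover, writing $t=\alpha(n)$, the set $N_n=\{f\in\mathcal T_n : \operatorname{im}(f)\subseteq\{1,\dots,t\}\text{ and } \{1,\dots,t\}f=\{1\}\}$ is a null subsemigroup of $\mathcal T_n$ of size $\nu(n)$.
   Context: $\mathcal T_n$ is the full transformation semigroup on $\{1,\dots,n\}$ (maps written on the right); the rank of a transformation is the size of its image. A null semigroup is a semigroup $S$ with $S^2=\{z\}$ for some $z\in S$ (necessarily its zero). For $n\in\mathbb N$, $\xi(n)=\max\{t^{n-t} : t\in\{1,\dots,n\}\}$ and $\alpha(n)=\max\{t\in\{1,\dots,n\} : \xi(n)=t^{n-t}\}$, with the convention $0^0=1$. *)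

theory Defs
  imports "HOL-Algebra.Coset"
begin

definition subsemigroup :: "('a, 'b) monoid_scheme \<Rightarrow> 'a set \<Rightarrow> bool" where
  "subsemigroup G S \<longleftrightarrow>
     S \<noteq> {} \<and> S \<subseteq> carrier G \<and> (\<forall>x\<in>S. \<forall>y\<in>S. x \<otimes>\<^bsub>G\<^esub> y \<in> S)"

definition zero_of :: "('a, 'b) monoid_scheme \<Rightarrow> 'a set \<Rightarrow> 'a \<Rightarrow> bool" where
  "zero_of G S z \<longleftrightarrow>
     z \<in> S \<and> (\<forall>x\<in>S. x \<otimes>\<^bsub>G\<^esub> z = z \<and> z \<otimes>\<^bsub>G\<^esub> x = z)"

definition null_subsemigroup :: "('a, 'b) monoid_scheme \<Rightarrow> 'a set \<Rightarrow> bool" where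
  "null_subsemigroup G S \<longleftrightarrow> subsemigroup G S \<and> (\<exists>z\<in>S. S <#>\<^bsub>G\<^esub> S = {z})"

text \<open>Transformations are extensional functions on \<open>{1..n}\<close>. Maps act on the right,
  so the product of \<open>f\<close> and \<open>g\<close> applies \<open>f\<close> first.\<close>

definition full_trans :: "nat \<Rightarrow> (nat \<Rightarrow> nat) monoid" where
  "full_trans n =
     \<lparr>carrier = {1..n} \<rightarrow>\<^sub>E {1..n},
      mult = (\<lambda>f g. compose {1..n} g f),
      one = (\<lambda>x\<in>{1..n}. x)\<rparr>"

definition trans_rank :: "nat \<Rightarrow> (nat \<Rightarrow> nat) \<Rightarrow> nat" where
  "trans_rank n f = card (f ` {1..n})"

definition xi :: "nat \<Rightarrow> nat" where
  "xi n = Max {t ^ (n - t) | t. t \<in> {1..n}}"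

definition alpha :: "nat \<Rightarrow> nat" where
  "alpha n = Max {t \<in> {1..n}. xi n = t ^ (n - t)}"

definition nu :: "nat \<Rightarrow> nat" where
  "nu n = Max {card S | S. null_subsemigroup (full_trans n) S}"

definition nu_rank :: "nat \<Rightarrow> nat \<Rightarrow> nat" where
  "nu_rank r n =
     Max {card S | S. null_subsemigroup (full_trans n) S \<and>
                      (\<exists>z. zero_of (full_trans n) S z \<and> trans_rank n z = r)}"

definition null_N :: "nat \<Rightarrow> (nat \<Rightarrow> nat) set" where
  "null_N n =
     {f \<in> carrier (full_trans n).
        f ` {1..n} \<subseteq> {1..alpha n} \<and> f ` {1..alpha n} = {1}}"

lemma monoid_full_trans: "monoid (full_trans n)"
proof (rule monoidI)
  fix x y z
  assume "x \<in> carrier (full_trans n)" "y \<in> carrier (full_trans n)" "z \<in> carrier (full_trans n)"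
  then show "x \<otimes>\<^bsub>full_trans n\<^esub> y \<otimes>\<^bsub>full_trans n\<^esub> z = x \<otimes>\<^bsub>full_trans n\<^esub> (y \<otimes>\<^bsub>full_trans n\<^esub> z)"
    by (fastforce simp: full_trans_def compose_def restrict_def PiE_def Pi_def)
qed (auto simp: full_trans_def compose_def restrict_def PiE_def extensional_def fun_eq_iff)

lemma null_subsemigroup_zero_unique:
  assumes "monoid G" "null_subsemigroup G S"
  shows "\<exists>!z. zero_of G S z" and "zero_of G S z \<longleftrightarrow> S <#>\<^bsub>G\<^esub> S = {z}"
proof -
  interpret monoid G by fact
  from assms obtain w where w: "w \<in> S" "S <#>\<^bsub>G\<^esub> S = {w}" and S: "S \<subseteq> carrier G"
    by (auto simp: null_subsemigroup_def subsemigroup_def)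
  have m: "x \<otimes>\<^bsub>G\<^esub> y = w" if "x \<in> S" "y \<in> S" for x y
    using w that by (auto simp: set_mult_def)
  have z: "zero_of G S z \<longleftrightarrow> z = w" for z
    using w m by (auto simp: zero_of_def)
  show "\<exists>!z. zero_of G S z" using z by auto
  show "zero_of G S z \<longleftrightarrow> S <#>\<^bsub>G\<^esub> S = {z}" using z w by auto
qed

lemma finite_null_cards:
  "finite {card S | S. null_subsemigroup (full_trans n) S \<and> P S}"
proof -
  have "finite (carrier (full_trans n))"
    by (simp add: full_trans_def finite_PiE)
  then have "finite (card ` Pow (carrier (full_trans n)))" by simp
  then show ?thesis
    by (rule rev_finite_subset) (auto simp: null_subsemigroup_def subsemigroup_def)
qed

lemma nonempty_null_cards:
  assumes "1 \<le> r" "r \<le> n"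
  shows "{card S | S. null_subsemigroup (full_trans n) S \<and>
            (\<exists>z. zero_of (full_trans n) S z \<and> trans_rank n z = r)} \<noteq> {}"
proof -
  define z where "z = (\<lambda>x\<in>{1..n}. min x r)"
  have c: "z \<in> carrier (full_trans n)"
    using assms by (auto simp: z_def full_trans_def)
  have m: "z \<otimes>\<^bsub>full_trans n\<^esub> z = z"
    using assms by (auto simp: z_def full_trans_def compose_def fun_eq_iff)
  have "z ` {1..n} = {1..r}"
  proof
    show "{1..r} \<subseteq> z ` {1..n}"
    proof
      fix x assume "x \<in> {1..r}"
      then show "x \<in> z ` {1..n}"
        using assms by (intro image_eqI[of _ _ x]) (auto simp: z_def)
    qed
  qed (use assms in \<open>auto simp: z_def\<close>)
  then have "trans_rank n z = r" by (simp add: trans_rank_def)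
  moreover have "null_subsemigroup (full_trans n) {z}"
    using c m by (auto simp: null_subsemigroup_def subsemigroup_def set_mult_def)
  moreover have "zero_of (full_trans n) {z} z"
    using m by (simp add: zero_of_def)
  ultimately show ?thesis by blast
qed

end

theory Submission
  imports Defs
begin

text \<open>
  Let \<open>S\<close> be a null subsemigroup with zero \<open>z\<close> of rank \<open>r\<close>, and let \<open>I\<close> be the union of the
  images of its elements, of size \<open>t\<close>. Since all products equal \<open>z\<close>, every element of \<open>S\<close> agrees
  with \<open>z\<close> on \<open>I\<close> and preserves the kernel classes of \<open>z\<close>. Hence it is determined by its values
  on the \<open>n - t\<close> points outside \<open>I\<close>, and each value lies in the intersection of \<open>I\<close> with one
  kernel class. The other \<open>r - 1\<close> classes each contain a point of \<open>im z \<subseteq> I\<close>, so there are at most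
  \<open>v = t - r + 1\<close> choices per point, and \<open>|S| \<le> v ^ (n - t) = v ^ ((n - r + 1) - v)\<close>.
  Conversely, fixing \<open>r - 1\<close> points, collapsing \<open>v\<close> further points to \<open>1\<close> and sending the
  remaining points arbitrarily to those \<open>v\<close> points attains this bound for every \<open>v\<close>.
\<close>

section \<open>Monotonicity and small values of \<open>xi\<close>\<close>

lemma xi_ge: "1 \<le> t \<Longrightarrow> t \<le> n \<Longrightarrow> t ^ (n - t) \<le> xi n"
  unfolding xi_def by (rule Max_ge) auto

lemma xi_attained:
  assumes "1 \<le> n"
  obtains t where "t \<in> {1..n}" "xi n = t ^ (n - t)"
proof -
  have "xi n \<in> {t ^ (n - t) | t. t \<in> {1..n}}"
    unfolding xi_def using assms by (intro Max_in) auto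
  then show thesis using that by blast
qed

text \<open>A maximising base \<open>t > 1\<close> for \<open>n\<close> gains one in the exponent
  when \<open>n\<close> grows by one. If \<open>t = 1\<close>, then \<open>xi n = 1\<close>, and
  base 2 does better because \<open>n - 1\<close> is positive.\<close>

lemma xi_Suc_less:
  assumes "2 \<le> n"
  shows "xi n < xi (Suc n)"
proof -
  obtain t where t: "t \<in> {1..n}" "xi n = t ^ (n - t)"
    using assms xi_attained[of n] by auto
  show ?thesis
  proof (cases "t = 1")
    case True
    have "1 < (2::nat) ^ (Suc n - 2)"
      using assms by (intro one_less_power) auto
    also have "\<dots> \<le> xi (Suc n)"
      using assms by (intro xi_ge) auto
    finally show ?thesis using t True by simp
  next
    case False
    then have "t ^ (n - t) < t ^ (Suc n - t)"
      using t by (intro power_strict_increasing) auto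
    also have "\<dots> \<le> xi (Suc n)"
      using t by (intro xi_ge) auto
    finally show ?thesis using t by simp
  qed
qed

lemma xi_1: "xi 1 = 1"
  by (auto simp: xi_def)

lemma xi_2: "xi 2 = 1"
proof -
  obtain t where t: "t \<in> {1..2}" "xi 2 = t ^ (2 - t)"
    using xi_attained[of 2] by auto
  then have "t = 1 \<or> t = 2" by auto
  then show ?thesis using t by auto
qed

text \<open>The step from 1 to 2 is an equality, both values being 1; every later step is strict by
  \<open>xi_Suc_less\<close>.\<close>

lemma xi_mono:
  assumes "1 \<le> m" "m \<le> n"
  shows "xi m \<le> xi n"
  using assms(2)
proof (induction n rule: dec_induct)
  case (step k)
  show ?case
  proof (cases "k = 1")
    case True
    then show ?thesis using step assms(1) xi_1 xi_2
      by (simp add: numeral_2_eq_2)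
  next
    case False
    then show ?thesis using step assms(1) xi_Suc_less[of k] by simp
  qed
qed simp

section \<open>Upper bound for a given rank of the zero\<close>

lemma null_subsemigroup_mult_eq_zero:
  assumes "null_subsemigroup G S" "zero_of G S z" "x \<in> S" "y \<in> S"
  shows "x \<otimes>\<^bsub>G\<^esub> y = z"
proof -
  obtain w where "S <#>\<^bsub>G\<^esub> S = {w}"
    using assms(1) by (auto simp: null_subsemigroup_def)
  then have "a \<otimes>\<^bsub>G\<^esub> b = w" if "a \<in> S" "b \<in> S" for a b
    using that by (auto simp: set_mult_def)
  moreover from this have "z = w"
    using assms(2) by (auto simp: zero_of_def)
  ultimately show ?thesis using assms by blast
qed

lemma card_null_subsemigroup_le:
  assumes null: "null_subsemigroup (full_trans n) S"
    and zero: "zero_of (full_trans n) S z"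
    and "n \<ge> 1"
  shows "card S \<le> xi (n - trans_rank n z + 1)"
proof -
  define X where "X = {1..n}"
  define r where "r = trans_rank n z"
  define I where "I = (\<Union>f\<in>S. f ` X)"
  define B where "B = (\<lambda>x. {y \<in> I. z y = z x})"
  have SX: "f \<in> X \<rightarrow>\<^sub>E X" if "f \<in> S" for f
    using null that
    by (auto simp: null_subsemigroup_def subsemigroup_def full_trans_def X_def)
  have zS: "z \<in> S" using zero by (simp add: zero_of_def)
  have prod: "g (f x) = z x" if "f \<in> S" "g \<in> S" "x \<in> X" for f g x
    using null_subsemigroup_mult_eq_zero[OF null zero that(1,2)] that(3)
    by (auto simp: full_trans_def X_def compose_def fun_eq_iff split: if_splits)
  have onI: "f y = z y" if f: "f \<in> S" and y: "y \<in> I" for f y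
  proof -
    obtain g x where "g \<in> S" "x \<in> X" "y = g x"
      using y by (auto simp: I_def)
    \<comment> \<open>With \<open>y = g x\<close>, both \<open>f (g x)\<close> and
      \<open>z (g x)\<close> equal \<open>z x\<close>.\<close>
    then show ?thesis using prod[of g f x] prod[of g z x] f zS by simp
  qed
  have IX: "I \<subseteq> X" using SX by (auto simp: I_def)
  have finX: "finite X" and cX: "card X = n" by (simp_all add: X_def)
  have finI: "finite I" using finX IX finite_subset by blast
  have zI: "z ` X \<subseteq> I" using zS by (auto simp: I_def)
  have r: "r = card (z ` X)" by (simp add: r_def trans_rank_def X_def)
  have "X \<noteq> {}" using \<open>n \<ge> 1\<close> by (simp add: X_def)
  then have r1: "1 \<le> r" using r finX by (simp add: Suc_le_eq card_gt_0_iff)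
  have rI: "r \<le> card I" unfolding r using finI zI by (rule card_mono)
  have In: "card I \<le> n" using card_mono[OF finX IX] cX by simp
  have cardB: "card (B x) \<le> card I + 1 - r" if "x \<in> X" for x
  proof -
    \<comment> \<open>As \<open>z\<close> is idempotent, it fixes its image pointwise, so
      \<open>z x\<close> is the only image point of \<open>z\<close> that can lie in
      \<open>B x\<close>. The other \<open>r - 1\<close> image points use up room in
      \<open>I\<close> outside \<open>B x\<close>.\<close>
    have disj: "B x \<inter> (z ` X - {z x}) = {}"
      using prod[OF zS zS] by (auto simp: B_def)
    have "card (B x) + card (z ` X - {z x}) = card (B x \<union> (z ` X - {z x}))"
      using finX finI disj by (intro card_Un_disjoint[symmetric]) (auto simp: B_def)
    also have "\<dots> \<le> card I"
      using finI zI by (intro card_mono) (auto simp: B_def)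
    finally show ?thesis using that r r1 finX by simp
  qed
  have "inj_on (\<lambda>f. restrict f (X - I)) S"
  proof (rule inj_onI)
    fix f g assume fg: "f \<in> S" "g \<in> S" "restrict f (X - I) = restrict g (X - I)"
    show "f = g"
    proof (rule PiE_ext[OF SX SX])
      fix x assume "x \<in> X"
      then show "f x = g x"
        using fg onI[of f x] onI[of g x] by (cases "x \<in> I") (auto dest: fun_cong[of _ _ x])
    qed (use fg in auto)
  qed
  moreover have "(\<lambda>f. restrict f (X - I)) ` S \<subseteq> (\<Pi>\<^sub>E x\<in>X - I. B x)"
  proof clarify
    fix f assume f: "f \<in> S"
    have "f x \<in> B x" if "x \<in> X - I" for x
      using prod[OF f zS] f that unfolding B_def I_def by blast
    then show "restrict f (X - I) \<in> (\<Pi>\<^sub>E x\<in>X - I. B x)" by simp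
  qed
  ultimately have "card S \<le> card (\<Pi>\<^sub>E x\<in>X - I. B x)"
    using finX finI by (intro card_inj_on_le) (auto simp: B_def intro!: finite_PiE)
  also have "\<dots> = (\<Prod>x\<in>X - I. card (B x))"
    using finX by (simp add: card_PiE)
  also have "\<dots> \<le> (\<Prod>x\<in>X - I. card I + 1 - r)"
    using cardB by (intro prod_mono) auto
  also have "\<dots> = (card I + 1 - r) ^ (n - card I)"
    using card_Diff_subset[OF finI IX] cX by simp
  \<comment> \<open>The exponent is rewritten so that the power becomes the term of
    \<open>xi (n - r + 1)\<close> with base \<open>card I + 1 - r\<close>.\<close>
  also have "n - card I = (n - r + 1) - (card I + 1 - r)"
    using r1 rI In by simp
  also have "(card I + 1 - r) ^ \<dots> \<le> xi (n - r + 1)"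
    using r1 rI In by (intro xi_ge) auto
  finally show ?thesis by (simp add: r_def)
qed

section \<open>Extremal families and the exact value for each rank\<close>

text \<open>The middle block consists of \<open>r - 1\<close> fixed points; together with the point
  1 they form the image of the zero. Writing the family as a product of sets makes its size a
  product of block sizes.\<close>

definition null_family :: "nat \<Rightarrow> nat \<Rightarrow> nat \<Rightarrow> (nat \<Rightarrow> nat) set" where
  "null_family n r v =
     (\<Pi>\<^sub>E x\<in>{1..n}. if x \<le> v then {1} else if x < v + r then {x} else {1..v})"

lemma card_null_family:
  assumes "1 \<le> r" "1 \<le> v" "v + r \<le> n + 1"
  shows "card (null_family n r v) = v ^ (n - r + 1 - v)"
proof -
  have "card (null_family n r v) = (\<Prod>x\<in>{1..n}. if x < v + r then 1 else v)"
    unfolding null_family_def using assms by (subst card_PiE) (auto intro!: prod.cong)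
  also have "\<dots> = (\<Prod>x\<in>{v + r..n}. v)"
    using assms by (intro prod.mono_neutral_cong_right) auto
  also have "\<dots> = v ^ (n - r + 1 - v)"
    using assms by (simp add: Suc_diff_le add.commute)
  finally show ?thesis .
qed

lemma null_family_null:
  assumes "1 \<le> r" "1 \<le> v" "v + r \<le> n + 1"
  obtains z where "null_subsemigroup (full_trans n) (null_family n r v)"
    "zero_of (full_trans n) (null_family n r v) z" "trans_rank n z = r"
proof -
  define S where "S = null_family n r v"
  \<comment> \<open>The zero is the member of the family that sends all top points to 1.\<close>
  define z where "z = (\<lambda>x\<in>{1..n}. if v < x \<and> x < v + r then x else 1)"
  have zS: "z \<in> S"
    using assms by (auto simp: S_def z_def null_family_def)
  have mem: "f x \<in> (if x \<le> v then {1} else if x < v + r then {x} else {1..v})"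
    if "f \<in> S" "x \<in> {1..n}" for f x
    using that unfolding S_def null_family_def by (rule PiE_mem)
  have low: "f x = 1" if "f \<in> S" "1 \<le> x" "x \<le> v" for f x
    using that assms mem[of f x] by simp
  have mid: "f x = x" if "f \<in> S" "v < x" "x < v + r" for f x
    using that assms mem[of f x] by simp
  have high: "f x \<in> {1..v}" if "f \<in> S" "v + r \<le> x" "x \<le> n" for f x
    using that assms mem[of f x] by simp
  have gf: "g (f x) = z x" if "f \<in> S" "g \<in> S" "x \<in> {1..n}" for f g x
  proof -
    \<comment> \<open>A top point is sent by \<open>f\<close> into \<open>{1..v}\<close>, which
      \<open>g\<close> then collapses to 1; a point of the other two blocks already reaches its
      final value under \<open>f\<close>.\<close>
    consider "x \<le> v" | "v < x" "x < v + r" | "v + r \<le> x" by linarith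
    then show ?thesis
      using that assms low[of f x] low[of g "f x"] mid[of f x] mid[of g x] high[of f x]
      by cases (auto simp: z_def)
  qed
  have prod: "f \<otimes>\<^bsub>full_trans n\<^esub> g = z" if "f \<in> S" "g \<in> S" for f g
    using gf[OF that] by (auto simp: full_trans_def compose_def fun_eq_iff z_def)
  have "f \<in> carrier (full_trans n)" if f: "f \<in> S" for f
  proof -
    have "f x \<in> {1..n}" if x: "x \<in> {1..n}" for x
    proof -
      consider "x \<le> v" | "v < x" "x < v + r" | "v + r \<le> x" by linarith
      then show ?thesis
        using f x assms low[of f x] mid[of f x] high[of f x] by cases auto
    qed
    moreover have "f \<in> extensional {1..n}"
      using f by (simp add: S_def null_family_def PiE_def)
    ultimately show ?thesis by (simp add: full_trans_def PiE_def)
  qed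
  then have "subsemigroup (full_trans n) S"
    using zS prod by (auto simp: subsemigroup_def)
  moreover have "S <#>\<^bsub>full_trans n\<^esub> S = {z}"
    using zS prod by (auto simp: set_mult_def)
  ultimately have 1: "null_subsemigroup (full_trans n) S"
    using zS by (auto simp: null_subsemigroup_def)
  have 2: "zero_of (full_trans n) S z"
    using zS prod by (auto simp: zero_of_def)
  have "z ` {1..n} = insert 1 {v<..<v + r}"
  proof
    show "insert 1 {v<..<v + r} \<subseteq> z ` {1..n}"
    proof
      fix y assume "y \<in> insert 1 {v<..<v + r}"
      then show "y \<in> z ` {1..n}"
        using assms by (intro image_eqI[of _ _ y]) (auto simp: z_def)
    qed
  qed (auto simp: z_def)
  then have "trans_rank n z = r"
    using assms by (simp add: trans_rank_def)
  with 1 2 show thesis using that by (simp add: S_def)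
qed

text \<open>Choosing \<open>v\<close> as a maximiser in \<open>xi (n - r + 1)\<close>, the family
  \<open>null_family n r v\<close> meets the upper bound.\<close>

lemma nu_rank_eq_xi:
  assumes "1 \<le> r" "r \<le> n"
  shows "nu_rank r n = xi (n - r + 1)"
proof -
  let ?P = "\<lambda>S. \<exists>z. zero_of (full_trans n) S z \<and> trans_rank n z = r"
  let ?C = "{card S | S. null_subsemigroup (full_trans n) S \<and> ?P S}"
  obtain v where v: "v \<in> {1..n - r + 1}" "xi (n - r + 1) = v ^ (n - r + 1 - v)"
    using xi_attained[of "n - r + 1"] by auto
  then have ok: "1 \<le> v" "v + r \<le> n + 1" using assms by auto
  have "Max ?C = xi (n - r + 1)"
  proof (rule Max_eqI)
    show "finite ?C" by (rule finite_null_cards)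
    show "c \<le> xi (n - r + 1)" if "c \<in> ?C" for c
      using that card_null_subsemigroup_le assms by fastforce
    obtain z where "null_subsemigroup (full_trans n) (null_family n r v)"
      "zero_of (full_trans n) (null_family n r v) z" "trans_rank n z = r"
      using null_family_null[OF assms(1) ok] .
    then show "xi (n - r + 1) \<in> ?C"
      using card_null_family[OF assms(1) ok] v(2) by force
  qed
  then show ?thesis by (simp add: nu_rank_def)
qed

section \<open>The overall maximum and the set \<open>null_N\<close>\<close>

lemma alpha_attains:
  assumes "1 \<le> n"
  shows "alpha n \<in> {1..n}" "xi n = alpha n ^ (n - alpha n)"
proof -
  have "alpha n \<in> {t \<in> {1..n}. xi n = t ^ (n - t)}"
    unfolding alpha_def using xi_attained[OF assms] by (intro Max_in) auto
  then show "alpha n \<in> {1..n}" "xi n = alpha n ^ (n - alpha n)" by auto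
qed

text \<open>For \<open>r = 1\<close> the block of fixed points is empty, so the results on
  \<open>null_family\<close> apply to \<open>null_N\<close>.\<close>

lemma null_N_eq_null_family:
  assumes "1 \<le> n"
  shows "null_N n = null_family n 1 (alpha n)"
proof -
  note a = alpha_attains(1)[OF assms]
  have "f \<in> null_N n \<longleftrightarrow> f \<in> null_family n 1 (alpha n)" for f
  proof
    assume f: "f \<in> null_N n"
    then have "f x = 1" if "1 \<le> x" "x \<le> alpha n" for x
      using that by (auto simp: null_N_def)
    moreover have "f x \<in> {1..alpha n}" if "x \<in> {1..n}" for x
      using f that unfolding null_N_def by blast
    moreover have "f \<in> extensional {1..n}"
      using f by (simp add: null_N_def full_trans_def PiE_def)
    ultimately show "f \<in> null_family n 1 (alpha n)"
      by (auto simp: null_family_def PiE_def Pi_def)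
  next
    assume f: "f \<in> null_family n 1 (alpha n)"
    have mem: "f x \<in> (if x \<le> alpha n then {1} else if x < alpha n + 1 then {x} else {1..alpha n})"
      if "x \<in> {1..n}" for x
      using f that unfolding null_family_def by (rule PiE_mem)
    have low: "f x = 1" if "1 \<le> x" "x \<le> alpha n" for x
      using that a mem[of x] by simp
    have all: "f x \<in> {1..alpha n}" if "x \<in> {1..n}" for x
      using that a mem[of x] by (simp split: if_splits)
    have "f ` {1..alpha n} = {1}"
      using a low by (auto intro!: image_eqI[of _ _ 1])
    moreover have "f \<in> extensional {1..n}"
      using f by (simp add: null_family_def PiE_def)
    moreover have "f \<in> {1..n} \<rightarrow> {1..n}"
      using a all by fastforce
    moreover have "f ` {1..n} \<subseteq> {1..alpha n}"
      using all by blast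
    ultimately show "f \<in> null_N n"
      by (simp add: null_N_def full_trans_def PiE_def)
  qed
  then show ?thesis by blast
qed

lemma null_N_null_subsemigroup:
  assumes "1 \<le> n"
  shows "null_subsemigroup (full_trans n) (null_N n)"
  using null_family_null[of 1 "alpha n" n] alpha_attains(1)[OF assms]
    null_N_eq_null_family[OF assms] by auto

lemma card_null_N:
  assumes "1 \<le> n"
  shows "card (null_N n) = xi n"
  using card_null_family[of 1 "alpha n" n] alpha_attains[OF assms]
    null_N_eq_null_family[OF assms] assms by simp

text \<open>Every null subsemigroup has a zero of rank at least 1, so by monotonicity of
  \<open>xi\<close> the bound for rank 1 covers all ranks.\<close>

lemma nu_eq_xi:
  assumes "1 \<le> n"
  shows "nu n = xi n"
proof -
  let ?C = "{card S | S. null_subsemigroup (full_trans n) S}"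
  have "Max ?C = xi n"
  proof (rule Max_eqI)
    show "finite ?C" using finite_null_cards[of n "\<lambda>_. True"] by simp
    show "xi n \<in> ?C"
      using null_N_null_subsemigroup[OF assms] card_null_N[OF assms] by force
    fix c assume "c \<in> ?C"
    then obtain S where S: "null_subsemigroup (full_trans n) S" "c = card S" by blast
    then obtain z where z: "zero_of (full_trans n) S z"
      using null_subsemigroup_zero_unique(1)[OF monoid_full_trans] by blast
    have "trans_rank n z \<ge> 1"
      using assms by (simp add: trans_rank_def Suc_le_eq card_gt_0_iff)
    then have "xi (n - trans_rank n z + 1) \<le> xi n"
      using assms by (intro xi_mono) auto
    then show "c \<le> xi n"
      using card_null_subsemigroup_le[OF S(1) z assms] S(2) by simp
  qed
  then show ?thesis by (simp add: nu_def)
qed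

theorem theorem4p4:
  fixes n :: nat
  assumes "n \<ge> 1"
  shows "(\<forall>r\<in>{1..n}. nu_rank r n = xi (n - r + 1)) \<and>
         ((\<forall>r. 1 \<le> r \<and> r + 1 \<le> n - 1 \<longrightarrow> nu_rank r n > nu_rank (r + 1) n) \<and>
          (n \<ge> 2 \<longrightarrow> nu_rank (n - 1) n = nu_rank n n) \<and>
          nu_rank n n = 1) \<and>
         (nu n = nu_rank 1 n \<and> nu_rank 1 n = xi n \<and>
          null_subsemigroup (full_trans n) (null_N n) \<and>
          card (null_N n) = nu n)"
proof -
  have rank1: "nu_rank 1 n = xi n"
    using nu_rank_eq_xi[of 1 n] assms by simp
  have rankn: "nu_rank n n = 1"
    using nu_rank_eq_xi[of n n] assms xi_1 by simp
  have "nu_rank (n - 1) n = 1" if "n \<ge> 2"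
  proof -
    have "n - (n - 1) + 1 = 2" using that by simp
    then show ?thesis
      using nu_rank_eq_xi[of "n - 1" n] that xi_2 by (simp add: numeral_2_eq_2)
  qed
  moreover have "nu_rank (r + 1) n < nu_rank r n" if "1 \<le> r" "r + 1 \<le> n - 1" for r
  proof -
    \<comment> \<open>The range of \<open>r\<close> keeps the smaller argument of \<open>xi\<close>
      at least 2, where growth is strict.\<close>
    have "Suc (n - (r + 1) + 1) = n - r + 1" "2 \<le> n - (r + 1) + 1"
      using that by auto
    then show ?thesis
      using nu_rank_eq_xi[of r n] nu_rank_eq_xi[of "r + 1" n] that
        xi_Suc_less[of "n - (r + 1) + 1"] by simp
  qed
  moreover have "\<forall>r\<in>{1..n}. nu_rank r n = xi (n - r + 1)"
    using nu_rank_eq_xi by simp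
  ultimately show ?thesis
    using rank1 rankn nu_eq_xi[OF assms] card_null_N[OF assms]
      null_N_null_subsemigroup[OF assms] by presburger
qed

end
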